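(* Let $P(z)=\sum_{j=0}^{m}A_jz^j$, with $A_j\in\mathbb{M}_{n,n}$, be a matrix polynomial of degree $m\ge 1$ with $A_0$ and $A_m$ non-singular, such that for some real $k\ge 1$, $$k\|A_m\|_F\ge\|A_{m-1}\|_F\ge\cdots\ge\|A_1\|_F\ge\|A_0\|_F,$$ and such that for some non-zero matrix $C\in\mathbb{M}_{n,n}$ and some real $\alpha$, $\angle(A_j,C)\le\alpha\le\frac{\pi}{2}$ for $j=0,1,2,\dots,m$. Then all eigenvalues of $P(z)$ lie in $$|z+k-1|\le\frac{1}{\|A_m^{-1}\|_F^{-1}}\left\{(k\|A_m\|_F-\|A_0\|_F)(\sin\alpha+\cos\alpha)+\|A_0\|_F+2\sin\alpha\sum_{j=0}^{m-1}\|A_j\|_F\right\}.$$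
   Context: $\mathbb{M}_{n,n}$ denotes the set of $n\times n$ complex matrices. A matrix polynomial of degree $m$ is a function $P(z)=\sum_{j=0}^m A_jz^j$ with $A_j\in\mathbb{M}_{n,n}$ and $A_m\ne0$. An eigenvalue of $P(z)$ is a number $\lambda\in\mathbb{C}$ for which there is a non-zero vector $u\in\mathbb{C}^n$ with $P(\lambda)u=0$. $\|\cdot\|_F$ is the Frobenius norm, induced by the Frobenius inner product $\langle A,B\rangle=\mathrm{tr}(B^*A)$, where $B^*$ is the conjugate transpose. For non-zero $A,B\in\mathbb{M}_{n,n}$, $\angle(A,B)\in[0,\pi]$ is the angle between $A$ and $B$ with respect to this inner product: $\cos\angle(A,B)=\dfrac{\mathrm{Re}\,\langle A,B\rangle}{\|A\|_F\|B\|_F}$. *)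

theory Defs
  imports "HOL-Analysis.Analysis"
begin

type_synonym 'n cmat = "complex ^ 'n ^ 'n"

definition conj_transpose :: "'n::finite cmat \<Rightarrow> 'n cmat"
  where "conj_transpose B = (\<chi> i j. cnj (B $ j $ i))"

definition frob_inner :: "'n::finite cmat \<Rightarrow> 'n cmat \<Rightarrow> complex"
  where "frob_inner A B = trace (conj_transpose B ** A)"

text \<open>This agrees with the library's \<open>norm\<close> on this type (an iterated Euclidean norm).\<close>
definition frob_norm :: "'n::finite cmat \<Rightarrow> real"
  where "frob_norm A = sqrt (Re (frob_inner A A))"

text \<open>Only meaningful when both arguments are non-zero.\<close>
definition frob_angle :: "'n::finite cmat \<Rightarrow> 'n cmat \<Rightarrow> real"
  where "frob_angle A B = arccos (Re (frob_inner A B) / (frob_norm A * frob_norm B))"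

text \<open>The degree is \<open>m\<close> exactly when moreover \<open>A m \<noteq> 0\<close>.\<close>
definition matrix_poly :: "nat \<Rightarrow> (nat \<Rightarrow> 'n::finite cmat) \<Rightarrow> complex \<Rightarrow> 'n cmat"
  where "matrix_poly m A z = (\<Sum>j\<le>m. map_matrix (\<lambda>a. z ^ j * a) (A j))"

definition matrix_poly_eigenvalue :: "(complex \<Rightarrow> 'n::finite cmat) \<Rightarrow> complex \<Rightarrow> bool"
  where "matrix_poly_eigenvalue P l \<longleftrightarrow> (\<exists>u. u \<noteq> 0 \<and> P l *v u = 0)"

end

theory Submission
  imports Defs
begin

text \<open>
  Multiplying \<open>P(z)\<close> by \<open>1 - z\<close> and replacing the leading coefficient \<open>A\<^sub>m\<close> by
  \<open>B\<^sub>m = k A\<^sub>m\<close> (and \<open>B\<^sub>j = A\<^sub>j\<close> otherwise), an eigenpair \<open>(z, u)\<close> satisfies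
  \<open>z\<^sup>m (z + k - 1) A\<^sub>m u = B\<^sub>0 u + \<Sum> z\<^bsup>j+1\<^esup> (B\<^bsub>j+1\<^esub> - B\<^sub>j) u\<close>.
  For \<open>\<bar>z\<bar> > 1\<close> one divides by \<open>z\<^sup>m\<close> and bounds the increments of \<open>B\<close> through the angle
  condition; for \<open>\<bar>z\<bar> \<le> 1\<close> the left-hand side of the claim is at most \<open>k\<close>, and the right-hand
  side is at least \<open>\<parallel>A\<^sub>m\<^sup>-\<^sup>1\<parallel> \<parallel>k A\<^sub>m\<parallel> \<ge> k\<close> by the triangle inequality for the same increments.
\<close>

section \<open>Frobenius structure as the Euclidean structure of the library\<close>

lemma Re_frob_inner: "Re (frob_inner A B) = inner A B"
proof -
  have "Re (frob_inner A B) = (\<Sum>i\<in>UNIV. \<Sum>j\<in>UNIV. inner (A $ j $ i) (B $ j $ i))"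
    by (simp add: frob_inner_def trace_def matrix_matrix_mult_def conj_transpose_def
        inner_complex_def algebra_simps)
  also have "\<dots> = inner A B"
    unfolding inner_vec_def by (rule sum.swap)
  finally show ?thesis .
qed

lemma frob_norm_eq_norm: "frob_norm A = norm A"
  by (simp add: frob_norm_def Re_frob_inner norm_eq_sqrt_inner)

text \<open>Cauchy-Schwarz bounds each coordinate by the norm of the matching row times
  \<open>norm u\<close>, and the L2 sum of the row norms is \<open>norm M\<close>.\<close>

lemma norm_matrix_vector_mult_le:
  fixes M :: "'a::real_normed_field ^ 'n ^ 'm"
  shows "norm (M *v u) \<le> norm M * norm u"
proof -
  have "norm ((M *v u) $ i) \<le> norm u * norm (M $ i)" for i
  proof -
    have "norm ((M *v u) $ i) \<le> (\<Sum>j\<in>UNIV. \<bar>norm (M $ i $ j)\<bar> * \<bar>norm (u $ j)\<bar>)"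
      unfolding matrix_vector_mult_def by (simp add: sum_norm_le norm_mult)
    also have "\<dots> \<le> norm (M $ i) * norm u"
      unfolding norm_vec_def by (rule L2_set_mult_ineq)
    finally show ?thesis by (simp add: mult.commute)
  qed
  then have "norm (M *v u) \<le> L2_set (\<lambda>i. norm u * norm (M $ i)) UNIV"
    unfolding norm_vec_def[of "M *v u"] by (intro L2_set_mono) auto
  also have "\<dots> = norm M * norm u"
    by (simp add: L2_set_right_distrib norm_vec_def[of M] mult.commute)
  finally show ?thesis .
qed

lemma norm_le_norm_matrix_inv_mult:
  fixes M :: "'a::real_normed_field ^ 'n ^ 'n"
  assumes "invertible M"
  shows "norm u \<le> norm (matrix_inv M) * norm (M *v u)"
proof -
  have "matrix_inv M ** M = mat 1"
    using someI_ex[OF assms[unfolded invertible_def]] by (simp add: matrix_inv_def)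
  then have "u = matrix_inv M *v (M *v u)"
    by (simp add: matrix_vector_mul_assoc)
  then show ?thesis
    by (metis norm_matrix_vector_mult_le)
qed

section \<open>Vectors in a cone about a unit axis\<close>

text \<open>Splits \<open>a\<close> and \<open>b\<close> into their components along and orthogonal to \<open>c\<close>.\<close>

lemma inner_ge_cos_double:
  fixes a b c :: "'a::real_inner"
  assumes c: "norm c = 1"
    and a: "norm a * cos \<alpha> \<le> inner a c" and b: "norm b * cos \<alpha> \<le> inner b c"
    and \<alpha>: "0 \<le> \<alpha>" "\<alpha> \<le> pi / 2"
  shows "norm a * norm b * cos (2 * \<alpha>) \<le> inner a b"
proof -
  have cos: "0 \<le> cos \<alpha>" and sin: "0 \<le> sin \<alpha>"
    using \<alpha> by (auto intro: cos_ge_zero sin_ge_zero)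
  have cc: "inner c c = 1"
    using c by (simp add: dot_square_norm)
  \<comment> \<open>By Pythagoras, a lower bound on the component along \<open>c\<close> is an upper
    bound on the orthogonal remainder.\<close>
  have orth: "norm (x - inner x c *\<^sub>R c) \<le> norm x * sin \<alpha>"
    if x: "norm x * cos \<alpha> \<le> inner x c" for x
  proof (rule power2_le_imp_le)
    have "(norm (x - inner x c *\<^sub>R c))\<^sup>2 = (norm x)\<^sup>2 - (inner x c)\<^sup>2"
      unfolding power2_norm_eq_inner
      by (simp add: inner_diff_left inner_diff_right cc inner_commute power2_eq_square)
    also have "\<dots> \<le> (norm x)\<^sup>2 - (norm x * cos \<alpha>)\<^sup>2"
      using power_mono[OF x, of 2] cos by simp
    also have "\<dots> = (norm x * sin \<alpha>)\<^sup>2"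
      by (simp add: power_mult_distrib sin_squared_eq algebra_simps)
    finally show "(norm (x - inner x c *\<^sub>R c))\<^sup>2 \<le> (norm x * sin \<alpha>)\<^sup>2" .
  qed (use sin in simp)
  define a' b' where "a' = a - inner a c *\<^sub>R c" and "b' = b - inner b c *\<^sub>R c"
  have "inner a b = inner a c * inner b c + inner a' b'"
    by (simp add: a'_def b'_def inner_diff_left inner_diff_right cc inner_commute)
  \<comment> \<open>Since \<open>cos \<alpha>\<close> is nonnegative, so are both components along
    \<open>c\<close>, and their lower bounds may be multiplied.\<close>
  moreover have "(norm a * cos \<alpha>) * (norm b * cos \<alpha>) \<le> inner a c * inner b c"
    using a b cos by (intro mult_mono) (auto intro: order_trans[rotated])
  moreover have "- inner a' b' \<le> (norm a * sin \<alpha>) * (norm b * sin \<alpha>)"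
  proof -
    have "- inner a' b' \<le> norm a' * norm b'"
      using Cauchy_Schwarz_ineq2[of a' b'] by linarith
    also have "\<dots> \<le> (norm a * sin \<alpha>) * (norm b * sin \<alpha>)"
      using orth[OF a] orth[OF b] sin by (intro mult_mono) (auto simp: a'_def b'_def)
    finally show ?thesis .
  qed
  ultimately show ?thesis
    unfolding cos_double by (simp add: power2_eq_square algebra_simps)
qed

text \<open>By the law of cosines and \<open>inner_ge_cos_double\<close>, the squared distance is at
  most the sum of the squares of the two summands on the right. Both are nonnegative, so this is at
  most the square of their sum.\<close>

lemma norm_diff_le_of_cone:
  fixes a b c :: "'a::real_inner"
  assumes c: "norm c = 1"
    and a: "norm a * cos \<alpha> \<le> inner a c" and b: "norm b * cos \<alpha> \<le> inner b c"
    and \<alpha>: "0 \<le> \<alpha>" "\<alpha> \<le> pi / 2"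
    and ba: "norm b \<le> norm a"
  shows "norm (a - b) \<le> (norm a - norm b) * cos \<alpha> + (norm a + norm b) * sin \<alpha>"
proof (rule power2_le_imp_le)
  have cos: "0 \<le> cos \<alpha>" and sin: "0 \<le> sin \<alpha>"
    using \<alpha> by (auto intro: cos_ge_zero sin_ge_zero)
  let ?x = "(norm a - norm b) * cos \<alpha>" and ?y = "(norm a + norm b) * sin \<alpha>"
  have xy: "0 \<le> ?x" "0 \<le> ?y"
    using cos sin ba by auto
  have "(norm (a - b))\<^sup>2 = (norm a)\<^sup>2 + (norm b)\<^sup>2 - 2 * inner a b"
    by (simp add: power2_norm_eq_inner inner_diff_left inner_diff_right inner_commute)
  also have "\<dots> \<le> (norm a)\<^sup>2 + (norm b)\<^sup>2 - 2 * (norm a * norm b * cos (2 * \<alpha>))"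
    using inner_ge_cos_double[OF c a b \<alpha>] by simp
  \<comment> \<open>Inserting sin^2 + cos^2 = 1 completes the squares: the cos^2 terms collect to
    (|a| - |b|)^2, the sin^2 terms to (|a| + |b|)^2.\<close>
  also have "\<dots> = ((norm a)\<^sup>2 + (norm b)\<^sup>2) * ((sin \<alpha>)\<^sup>2 + (cos \<alpha>)\<^sup>2)
      - 2 * (norm a * norm b * cos (2 * \<alpha>))"
    by simp
  also have "\<dots> = ?x\<^sup>2 + ?y\<^sup>2"
    unfolding cos_double by algebra
  also have "\<dots> \<le> (?x + ?y)\<^sup>2"
    using xy by (simp add: power2_sum)
  finally show "(norm (a - b))\<^sup>2 \<le> (?x + ?y)\<^sup>2" .
  show "0 \<le> ?x + ?y" using xy by simp
qed

section \<open>Telescoping sums\<close>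

text \<open>With r and s the norms of consecutive terms, (s - r) cos + (s + r) sin = (s - r)(sin +
  cos) + 2 r sin, and the first part telescopes.\<close>

lemma sum_norm_increments_le:
  fixes a :: "nat \<Rightarrow> 'a::real_inner"
  assumes c: "norm c = 1"
    and cone: "\<And>j. j \<le> m \<Longrightarrow> norm (a j) * cos \<alpha> \<le> inner (a j) c"
    and \<alpha>: "0 \<le> \<alpha>" "\<alpha> \<le> pi / 2"
    and mono: "\<And>j. j < m \<Longrightarrow> norm (a j) \<le> norm (a (Suc j))"
  shows "(\<Sum>j<m. norm (a (Suc j) - a j))
    \<le> (norm (a m) - norm (a 0)) * (sin \<alpha> + cos \<alpha>) + 2 * sin \<alpha> * (\<Sum>j<m. norm (a j))"
proof -
  have "(\<Sum>j<m. norm (a (Suc j) - a j))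
      \<le> (\<Sum>j<m. (norm (a (Suc j)) - norm (a j)) * (sin \<alpha> + cos \<alpha>) + 2 * sin \<alpha> * norm (a j))"
  proof (rule sum_mono)
    fix j assume "j \<in> {..<m}"
    then have "norm (a (Suc j) - a j) \<le> (norm (a (Suc j)) - norm (a j)) * cos \<alpha>
        + (norm (a (Suc j)) + norm (a j)) * sin \<alpha>"
      by (intro norm_diff_le_of_cone[OF c] cone \<alpha> mono) auto
    then show "norm (a (Suc j) - a j)
        \<le> (norm (a (Suc j)) - norm (a j)) * (sin \<alpha> + cos \<alpha>) + 2 * sin \<alpha> * norm (a j)"
      by (simp add: algebra_simps)
  qed
  also have "\<dots> = (\<Sum>j<m. norm (a (Suc j)) - norm (a j)) * (sin \<alpha> + cos \<alpha>)
      + 2 * sin \<alpha> * (\<Sum>j<m. norm (a j))"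
    by (simp only: sum.distrib sum_distrib_left sum_distrib_right)
  also have "(\<Sum>j<m. norm (a (Suc j)) - norm (a j)) = norm (a m) - norm (a 0)"
    by (rule sum_lessThan_telescope)
  finally show ?thesis .
qed

lemma norm_le_sum_norm_increments:
  fixes a :: "nat \<Rightarrow> 'a::real_normed_vector"
  shows "norm (a m) \<le> norm (a 0) + (\<Sum>j<m. norm (a (Suc j) - a j))"
proof -
  have "norm (a m - a 0) \<le> (\<Sum>j<m. norm (a (Suc j) - a j))"
    using norm_sum[of "\<lambda>j. a (Suc j) - a j" "{..<m}"] by (simp add: sum_lessThan_telescope)
  then show ?thesis
    using norm_triangle_sub[of "a m" "a 0"] by linarith
qed

text \<open>Multiplying a polynomial by 1 - z turns its coefficients into differences; the leftover
  top term is moved to the right.\<close>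

lemma sum_increments_powers:
  fixes b :: "nat \<Rightarrow> 'a::comm_ring_1"
  shows "b 0 + (\<Sum>j<m. z ^ Suc j * (b (Suc j) - b j))
    = (1 - z) * (\<Sum>j\<le>m. z ^ j * b j) + z ^ Suc m * b m"
  by (induction m) (simp_all add: algebra_simps)

text \<open>Cauchy-Schwarz puts the quotient into the range where \<open>arccos\<close> inverts
  \<open>cos\<close>, and \<open>cos\<close> decreases on [0, pi]. The resulting inequality is
  homogeneous in \<open>A\<close>, so it survives scaling by \<open>k\<close>.\<close>

lemma frob_angle_nonneg: "A \<noteq> 0 \<Longrightarrow> C \<noteq> 0 \<Longrightarrow> 0 \<le> frob_angle A C"
  and frob_angle_le_imp_cone:
    "A \<noteq> 0 \<Longrightarrow> C \<noteq> 0 \<Longrightarrow> frob_angle A C \<le> \<alpha> \<Longrightarrow> \<alpha> \<le> pi / 2 \<Longrightarrow>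
      norm A * cos \<alpha> \<le> inner A (sgn C)"
proof -
  let ?q = "inner A C / (norm A * norm C)"
  assume nz: "A \<noteq> 0" "C \<noteq> 0"
  have "\<bar>?q\<bar> \<le> 1"
    using nz Cauchy_Schwarz_ineq2[of A C] by (simp add: divide_simps)
  then have q: "-1 \<le> ?q" "?q \<le> 1"
    by (auto simp only: abs_le_iff)
  have eq: "frob_angle A C = arccos ?q"
    by (simp add: frob_angle_def Re_frob_inner frob_norm_eq_norm)
  show nonneg: "0 \<le> frob_angle A C"
    unfolding eq by (rule arccos_lbound[OF q])
  assume "frob_angle A C \<le> \<alpha>" "\<alpha> \<le> pi / 2"
  then have "cos \<alpha> \<le> cos (frob_angle A C)"
    using nonneg by (intro cos_monotone_0_pi_le) auto
  also have "\<dots> = ?q"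
    unfolding eq by (rule cos_arccos[OF q])
  finally have "norm A * cos \<alpha> \<le> norm A * ?q"
    by (intro mult_left_mono) auto
  also have "\<dots> = inner A (sgn C)"
    using nz by (simp add: sgn_div_norm divide_simps)
  finally show "norm A * cos \<alpha> \<le> inner A (sgn C)" .
qed

text \<open>Separates the algebra from the geometry: the bound involves only the increments of
  \<open>B\<close>, which the cone condition controls later.\<close>

lemma eigenvalue_bound:
  fixes A :: "nat \<Rightarrow> 'n::finite cmat" and k :: real
  assumes inv: "invertible (A m)" and k: "k \<ge> 1"
    and ev: "matrix_poly_eigenvalue (matrix_poly m A) l"
    and B: "B = A(m := k *\<^sub>R A m)"
  shows "cmod (l + of_real k - 1) \<le> norm (matrix_inv (A m))
    * (norm (B 0) + (\<Sum>j<m. norm (B (Suc j) - B j)))" (is "?t \<le> ?K * ?S")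
proof -
  obtain u where u: "u \<noteq> 0" and Pu: "matrix_poly m A l *v u = 0"
    using ev by (auto simp: matrix_poly_eigenvalue_def)
  define w where "w = A m *v u"
  have uw: "norm u \<le> ?K * norm w"
    unfolding w_def by (rule norm_le_norm_matrix_inv_mult[OF inv])
  have "?t * norm u \<le> ?K * ?S * norm u"
  proof (cases "cmod l \<le> 1")
    case True
    have "?t \<le> k"
      using True k norm_triangle_ineq[of l "of_real (k - 1)"]
      by (simp add: algebra_simps norm_of_real del: of_real_diff) (simp add: algebra_simps)
    then have "?t * norm u \<le> k * norm u"
      by (intro mult_right_mono) auto
    \<comment> \<open>Passing from \<open>u\<close> to \<open>w\<close> and back to \<open>u\<close>
      yields 1 \<le> \<open>?K * norm (A m)\<close>.\<close>
    also have "\<dots> \<le> k * (?K * norm w)"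
      using uw k by (intro mult_left_mono) auto
    also have "\<dots> \<le> k * (?K * (norm (A m) * norm u))"
      using k unfolding w_def by (intro mult_left_mono norm_matrix_vector_mult_le) auto
    also have "\<dots> = ?K * norm (B m) * norm u"
      using k by (simp add: B)
    also have "\<dots> \<le> ?K * ?S * norm u"
      by (intro mult_right_mono mult_left_mono norm_le_sum_norm_increments) auto
    finally show ?thesis .
  next
    case False
    define d where "d j = B (Suc j) - B j" for j
    \<comment> \<open>Taken coordinatewise, because \<open>sum_increments_powers\<close> multiplies
      in a commutative ring.\<close>
    have comp: "l ^ m * (l + of_real k - 1) * w $ i
        = (B 0 *v u) $ i + (\<Sum>j<m. l ^ Suc j * (d j *v u) $ i)" for i
    proof -
      define a where "a j = (A j *v u) $ i" for j
      define b where "b j = (B j *v u) $ i" for j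
      have "(matrix_poly m A l *v u) $ i = (\<Sum>j\<le>m. l ^ j * a j)"
        by (simp add: a_def matrix_poly_def matrix_vector_mult_def map_matrix_def sum_distrib_left
            sum_distrib_right mult.assoc sum.swap[of _ "{..m}"])
      then have "(\<Sum>j\<le>m. l ^ j * a j) = 0"
        using Pu by simp
      moreover have b: "b j = (if j = m then of_real k * a m else a j)" for j
        by (simp add: a_def b_def B matrix_vector_mult_def sum_distrib_left
            scaleR_conv_of_real[where 'a = complex] mult.assoc)
      \<comment> \<open>As \<open>P(l) u = 0\<close>, only the surplus (k - 1) of the scaled top
        coefficient survives.\<close>
      ultimately have sum_b: "(\<Sum>j\<le>m. l ^ j * b j) = l ^ m * (of_real k - 1) * a m"
        by (simp add: lessThan_Suc_atMost[symmetric] algebra_simps)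
      \<comment> \<open>The factor arises as (1 - l)(k - 1) + l k = l + k - 1.\<close>
      then have "b 0 + (\<Sum>j<m. l ^ Suc j * (b (Suc j) - b j)) = l ^ m * (l + of_real k - 1) * a m"
        unfolding sum_increments_powers sum_b by (simp add: b algebra_simps)
      then show ?thesis
        by (simp add: a_def b_def d_def w_def matrix_vector_mult_diff_rdistrib)
    qed
    have vec: "(l ^ m * (l + of_real k - 1)) *s w = B 0 *v u + (\<Sum>j<m. l ^ Suc j *s (d j *v u))"
      using comp by (simp add: vec_eq_iff)
    have norm_s: "norm (c *s x) = cmod c * norm x" for c and x :: "complex ^ 'n"
      by (simp add: norm_vec_def norm_mult L2_set_right_distrib)
    \<comment> \<open>Since \<open>cmod l > 1\<close>, the top power dominates all lower ones and
      can be cancelled as a common factor.\<close>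
    have pow: "cmod l ^ j \<le> cmod l ^ m" if "j \<le> m" for j
      using that False by (intro power_increasing) auto
    have "cmod l ^ m * (?t * norm w) = norm ((l ^ m * (l + of_real k - 1)) *s w)"
      by (simp add: norm_s norm_mult norm_power)
    also have "\<dots> \<le> norm (B 0 *v u) + (\<Sum>j<m. cmod l ^ Suc j * norm (d j *v u))"
      unfolding vec
      by (intro norm_triangle_mono sum_norm_le) (simp_all add: norm_s norm_mult norm_power)
    also have "\<dots> \<le> cmod l ^ m * (norm (B 0) * norm u)
        + (\<Sum>j<m. cmod l ^ m * (norm (d j) * norm u))"
    proof (intro add_mono sum_mono mult_mono norm_matrix_vector_mult_le pow)
      have "1 * norm (B 0 *v u) \<le> cmod l ^ m * (norm (B 0) * norm u)"
        using pow[of 0] by (intro mult_mono norm_matrix_vector_mult_le) auto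
      then show "norm (B 0 *v u) \<le> cmod l ^ m * (norm (B 0) * norm u)"
        by simp
    qed auto
    also have "\<dots> = cmod l ^ m * (?S * norm u)"
      by (simp add: d_def sum_distrib_left sum_distrib_right algebra_simps)
    finally have "cmod l ^ m * (?t * norm w) \<le> cmod l ^ m * (?S * norm u)" .
    moreover have "0 < cmod l ^ m"
      using False by (intro zero_less_power) linarith
    ultimately have tw: "?t * norm w \<le> ?S * norm u"
      by (rule mult_left_le_imp_le)
    have "?t * norm u \<le> ?t * (?K * norm w)"
      using uw by (intro mult_left_mono) auto
    also have "\<dots> \<le> ?K * (?S * norm u)"
      using mult_left_mono[OF tw, of ?K] by (simp add: algebra_simps)
    finally show ?thesis by (simp add: mult.assoc)
  qed
  then show ?thesis
    using u by simp
qed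

theorem theorem2:
  fixes A :: "nat \<Rightarrow> 'n::finite cmat" and C :: "'n cmat"
    and m :: nat and k \<alpha> :: real and l :: complex
  assumes "m \<ge> 1"
    and "A m \<noteq> 0"
    and "invertible (A 0)" and "invertible (A m)"
    and "k \<ge> 1"
    and "k * frob_norm (A m) \<ge> frob_norm (A (m - 1))"
    and "\<And>j. j + 1 < m \<Longrightarrow> frob_norm (A (j + 1)) \<ge> frob_norm (A j)"
    and "C \<noteq> 0"
    and "\<And>j. j \<le> m \<Longrightarrow> frob_angle (A j) C \<le> \<alpha>"
    and "\<alpha> \<le> pi / 2"
    and "matrix_poly_eigenvalue (matrix_poly m A) l"
  shows "cmod (l + of_real k - 1)
    \<le> 1 / inverse (frob_norm (matrix_inv (A m)))
      * ((k * frob_norm (A m) - frob_norm (A 0)) * (sin \<alpha> + cos \<alpha>)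
         + frob_norm (A 0) + 2 * sin \<alpha> * (\<Sum>j<m. frob_norm (A j)))"
proof -
  define B where "B = A(m := k *\<^sub>R A m)"
  have B: "B j = A j" if "j < m" for j
    using that by (simp add: B_def)
  have normBm: "norm (B m) = k * norm (A m)"
    using \<open>k \<ge> 1\<close> by (simp add: B_def)
  \<comment> \<open>With the growth of the norms, this makes every coefficient non-zero, so that all
    the angles are meaningful.\<close>
  have A0: "A 0 \<noteq> 0"
  proof
    assume "A 0 = 0"
    then obtain X where "(0 :: 'n cmat) ** X = mat 1"
      using \<open>invertible (A 0)\<close> by (auto simp: invertible_def)
    then show False
      by (auto simp: matrix_matrix_mult_def mat_def vec_eq_iff split: if_splits)
  qed
  \<comment> \<open>The factor \<open>k\<close> occurs only in the last comparison, so the norms of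
    \<open>B\<close> increase up to index \<open>m\<close>.\<close>
  have mono: "norm (B j) \<le> norm (B (Suc j))" if "j < m" for j
  proof (cases "Suc j = m")
    case True
    then show ?thesis
      using assms(6) that by (auto simp: frob_norm_eq_norm normBm B)
  next
    case False
    then show ?thesis
      using assms(7)[of j] that by (simp add: frob_norm_eq_norm B)
  qed
  have nz: "A j \<noteq> 0" if "j \<le> m" for j
  proof (cases "j = m")
    case False
    have "j < m \<Longrightarrow> norm (B 0) \<le> norm (B j)"
      by (induction j) (auto intro: order_trans[OF _ mono])
    then show ?thesis
      using False that A0 by (auto simp: B)
  qed (use \<open>A m \<noteq> 0\<close> in simp)
  have \<alpha>: "0 \<le> \<alpha>"
    using frob_angle_nonneg[OF nz[of 0] \<open>C \<noteq> 0\<close>] assms(9)[of 0] by simp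
  have coneA: "norm (A j) * cos \<alpha> \<le> inner (A j) (sgn C)" if "j \<le> m" for j
    using that assms(8-10) nz by (intro frob_angle_le_imp_cone) auto
  have coneB: "norm (B j) * cos \<alpha> \<le> inner (B j) (sgn C)" if "j \<le> m" for j
    using coneA[OF that] \<open>k \<ge> 1\<close> by (auto simp: B_def)
  have "norm (B 0) + (\<Sum>j<m. norm (B (Suc j) - B j))
      \<le> norm (B 0) + ((norm (B m) - norm (B 0)) * (sin \<alpha> + cos \<alpha>)
        + 2 * sin \<alpha> * (\<Sum>j<m. norm (B j)))"
    using \<open>C \<noteq> 0\<close> \<alpha> assms(10) coneB mono
    by (intro add_left_mono sum_norm_increments_le[of "sgn C"]) (auto simp: norm_sgn)
  \<comment> \<open>\<open>B\<close> differs from \<open>A\<close> only at \<open>m\<close>, and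
    \<open>m \<ge> 1\<close> keeps index 0 away from it.\<close>
  also have "\<dots> = (k * norm (A m) - norm (A 0)) * (sin \<alpha> + cos \<alpha>)
         + norm (A 0) + 2 * sin \<alpha> * (\<Sum>j<m. norm (A j))"
    using \<open>m \<ge> 1\<close> by (simp add: normBm B)
  finally have "norm (matrix_inv (A m)) * (norm (B 0) + (\<Sum>j<m. norm (B (Suc j) - B j)))
      \<le> norm (matrix_inv (A m)) * \<dots>"
    by (rule mult_left_mono) simp
  with eigenvalue_bound[OF assms(4,5,11) B_def] show ?thesis
    by (simp add: frob_norm_eq_norm divide_inverse mult.commute)
qed

end
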